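(* Let $\bar\beta_0+\sum_{j=1}^n\bar\beta_jx_j+\beta' y\ge 0$ and $\hat\beta_0+\sum_{j=1}^n\hat\beta_jx_j+\beta' y\ge 0$ be any two valid core inequalities (with the same $\beta'$). If $$\mathcal{L}_k(\bar\beta_0,\bar\beta)\le\mathcal{L}_k(\hat\beta_0,\hat\beta)\qquad\text{for all }k\in\{0,\dots,n\},$$ with strict inequality holding for at least one $k$, then the inequality $\hat\beta_0+\sum_{j=1}^n\hat\beta_jx_j+\beta' y\ge 0$ is not a facet of $\operatorname{conv}(G)$.
   Context: Let $n\ge 2$, $N=\{1,\dots,n\}$, and let $\ell<u$ be real numbers. Let $X=\{x\in\mathbb{R}^n:\ell\le x_j\le u,\ j\in N\}$. For real coefficients $c_2,\dots,c_n$, not all zero, let $m(x)=\sum_{i=2}^n c_i\sum_{J\subseteq N,\ |J|=i}\prod_{j\in J}x_j$, and let $G=\{(x,y)\in\mathbb{R}^n\times\mathbb{R}: x\in X,\ y=m(x)\}$. The set $\operatorname{conv}(G)$ is a polytope of dimension $n+1$. A core inequality is a linear inequality $\beta_0+\sum_{j=1}^n\beta_jx_j+\beta' y\ge 0$ with $\beta'\in\{-1,1\}$ and $\beta_1\le\cdots\le\beta_n$; it is a valid core inequality if it is satisfied by all points of $\operatorname{conv}(G)$. An inequality "is a facet" of $\operatorname{conv}(G)$ if it is valid for $\operatorname{conv}(G)$ and the set of points of $\operatorname{conv}(G)$ satisfying it with equality is a facet of $\operatorname{conv}(G)$. For $k\in\{0,\dots,n\}$, $\mathcal{L}_k(\beta_0,\beta)=\beta_0+u\sum_{j=1}^k\beta_j+\ell\sum_{j=k+1}^n\beta_j$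 (empty sums are $0$), i.e. the value of $\beta_0+\sum_j\beta_jx_j$ at the point $x^k$ whose first $k$ entries are $u$ and whose last $n-k$ entries are $\ell$. *)

theory Defs
  imports "HOL-Analysis.Analysis"
begin

text \<open>
  The index set \<open>N = {1, ..., n}\<close> is rendered by a finite linearly ordered type \<open>'n\<close>,
  with \<open>n = CARD('n)\<close>; \<open>pos\<close> is the unique order isomorphism from \<open>'n\<close> onto \<open>{1, ..., n}\<close>.
\<close>

definition pos :: "'n::{finite,linorder} \<Rightarrow> nat" where
  "pos j = card {i. i \<le> j}"

definition boxX :: "real \<Rightarrow> real \<Rightarrow> (real ^ 'n) set" where
  "boxX l u = {x. \<forall>j. l \<le> x $ j \<and> x $ j \<le> u}"

definition symm_multilinear :: "(nat \<Rightarrow> real) \<Rightarrow> real ^ 'n \<Rightarrow> real" where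
  "symm_multilinear c x = (\<Sum>i = 2..CARD('n). c i * (\<Sum>J | card J = i. \<Prod>j\<in>J. x $ j))"

definition graphG :: "real \<Rightarrow> real \<Rightarrow> (nat \<Rightarrow> real) \<Rightarrow> ((real ^ 'n) \<times> real) set" where
  "graphG l u c = {(x, y). x \<in> boxX l u \<and> y = symm_multilinear c x}"

text \<open>The triple \<open>b0 b b'\<close> stands for the inequality \<open>0 \<le> ineq_lhs b0 b b' x y\<close>.\<close>

definition ineq_lhs :: "real \<Rightarrow> real ^ 'n \<Rightarrow> real \<Rightarrow> real ^ 'n \<Rightarrow> real \<Rightarrow> real" where
  "ineq_lhs b0 b b' x y = b0 + (\<Sum>j\<in>UNIV. b $ j * x $ j) + b' * y"

definition valid_ineq ::
  "((real ^ 'n) \<times> real) set \<Rightarrow> real \<Rightarrow> real ^ 'n \<Rightarrow> real \<Rightarrow> bool" where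
  "valid_ineq P b0 b b' \<longleftrightarrow> (\<forall>(x, y)\<in>P. ineq_lhs b0 b b' x y \<ge> 0)"

definition is_facet_ineq ::
  "((real ^ 'n) \<times> real) set \<Rightarrow> real \<Rightarrow> real ^ 'n \<Rightarrow> real \<Rightarrow> bool" where
  "is_facet_ineq P b0 b b' \<longleftrightarrow>
     valid_ineq P b0 b b' \<and> {(x, y) \<in> P. ineq_lhs b0 b b' x y = 0} facet_of P"

definition core_ineq :: "real ^ 'n::{finite,linorder} \<Rightarrow> real \<Rightarrow> bool" where
  "core_ineq b b' \<longleftrightarrow> b' \<in> {-1, 1} \<and> mono (\<lambda>j. b $ j)"

definition valid_core_ineq ::
  "((real ^ 'n::{finite,linorder}) \<times> real) set \<Rightarrow> real \<Rightarrow> real ^ 'n::{finite,linorder} \<Rightarrow> real \<Rightarrow> bool" where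
  "valid_core_ineq P b0 b b' \<longleftrightarrow> core_ineq b b' \<and> valid_ineq P b0 b b'"

definition Lval ::
  "real \<Rightarrow> real \<Rightarrow> nat \<Rightarrow> real \<Rightarrow> real ^ 'n::{finite,linorder} \<Rightarrow> real" where
  "Lval l u k b0 b = b0 + u * (\<Sum>j | pos j \<le> k. b $ j) + l * (\<Sum>j | pos j > k. b $ j)"

end

theory Submission
  imports Defs
begin

text \<open>
  Suppose that the second inequality defined a facet \<open>F\<close>, and let \<open>D\<close> be the affine function of \<open>x\<close>
  alone that is obtained by subtracting the left-hand side of the second inequality from that of
  the first; the terms \<open>b' y\<close> cancel. The plan is to show that \<open>D\<close> vanishes on \<open>F\<close>. As \<open>conv(G)\<close> has
  dimension \<open>n + 1\<close>, the facet spans the hyperplane where the second inequality is tight. That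
  hyperplane is not vertical, since \<open>b' \<noteq> 0\<close>, so it projects onto all of \<open>\<real>\<^sup>n\<close> and \<open>D\<close> is
  identically \<open>0\<close> (\<open>facet_subset_hyperplane_fst\<close>). This contradicts the strict inequality between
  two values \<open>L\<^sub>k\<close>.

  By Krein--Milman, \<open>F\<close> is the convex hull of its extreme points, which are extreme points of
  \<open>conv(G)\<close>. As \<open>m\<close> is affine in each coordinate, these lie above vertices of the box
  (\<open>extreme_point_graphG\<close>). So it suffices that \<open>D = 0\<close> at every vertex \<open>v\<^sub>S\<close>, with the entries in
  \<open>S\<close> equal to \<open>u\<close> and the others equal to \<open>l\<close>, at which the second inequality is tight
  (\<open>tight_vertex_agree\<close>).

  Let \<open>I\<close> consist of the \<open>card S\<close> smallest indices. By symmetry \<open>m\<close> takes the same value at \<open>v\<^sub>S\<close>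
  and \<open>v\<^sub>I\<close>, and since the coefficients increase, the linear part of a core inequality is at least
  as small at \<open>v\<^sub>I\<close> as at \<open>v\<^sub>S\<close>. Hence the second inequality is tight at \<open>v\<^sub>I\<close> too. There the
  first inequality is sandwiched between \<open>0\<close> and the second, so \<open>D(v\<^sub>I) = 0\<close>. It remains to move
  from \<open>I\<close> to \<open>S\<close>. The two vertices tie for the second inequality, so its coefficients are constant
  on the range of indices where \<open>I\<close> and \<open>S\<close> differ. On that range the coefficients of \<open>D\<close>
  therefore increase, as those of the first inequality do. On the other hand \<open>D \<le> 0\<close> at all
  vertices \<open>x\<^sup>k\<close> with equality at \<open>v\<^sub>I\<close>; a sequence of partial sums that is convex on a range and
  attains its maximum inside it is constant there, so the coefficients of \<open>D\<close> vanish on that range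
  and \<open>D(v\<^sub>S) = D(v\<^sub>I) = 0\<close> (\<open>sum_eq_of_max_on_down_sets\<close>).
\<close>

section \<open>Exchange arguments for sums over down-sets\<close>

text \<open>
  Down-sets replace the initial segments \<open>{1, ..., k}\<close> of the index set, so that sums over them can
  be compared without referring to positions.
\<close>

definition down_set :: "'a::order set \<Rightarrow> bool" where
  "down_set I \<longleftrightarrow> (\<forall>i j. j \<in> I \<longrightarrow> i \<le> j \<longrightarrow> i \<in> I)"

lemma down_set_less:
  fixes i j :: "'a::linorder"
  assumes "down_set I" "i \<in> I" "j \<notin> I"
  shows "i < j"
  using assms unfolding down_set_def by (meson not_le)

lemma down_set_ex_card:
  assumes "k \<le> CARD('n::{finite,linorder})"
  shows "\<exists>I :: 'n set. down_set I \<and> card I = k"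
  using assms
proof (induction k)
  case 0
  show ?case by (intro exI[of _ "{}"]) (auto simp: down_set_def)
next
  case (Suc k)
  then obtain I :: "'n set" where I: "down_set I" "card I = k" by auto
  have ne: "- I \<noteq> {}"
  proof
    assume "- I = {}"
    then have "I = UNIV" by auto
    with I(2) Suc.prems show False by simp
  qed
  define a where "a = Min (- I)"
  have a: "a \<notin> I" using Min_in[of "- I"] ne by (auto simp: a_def)
  have min: "i \<in> I" if "i < a" for i
  proof (rule ccontr)
    assume "i \<notin> I"
    then have "a \<le> i" using Min_le[of "- I" i] by (simp add: a_def)
    with that show False by simp
  qed
  have "down_set (insert a I)"
    using I(1) min unfolding down_set_def by (metis insert_iff le_less)
  moreover have "card (insert a I) = Suc k" using a I(2) by simp
  ultimately show ?case by blast
qed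

text \<open>
  This makes the values \<open>Lval\<close> available on down-sets: the \<open>k\<close> of a down-set is its cardinality.
\<close>

lemma down_set_eq_pos_le_card:
  fixes I :: "'n::{finite,linorder} set"
  assumes "down_set I"
  shows "{j. pos j \<le> card I} = I"
proof (intro set_eqI iffI)
  fix j :: 'n assume "j \<in> I"
  then have "{i. i \<le> j} \<subseteq> I" using assms by (auto simp: down_set_def)
  then show "j \<in> {j. pos j \<le> card I}" by (auto simp: pos_def intro: card_mono)
next
  fix j :: 'n assume j: "j \<in> {j. pos j \<le> card I}"
  show "j \<in> I"
  proof (rule ccontr)
    assume "j \<notin> I"
    then have "I \<subset> {i. i \<le> j}" using down_set_less[OF assms] by (force intro: less_imp_le)
    then have "card I < pos j" by (auto simp: pos_def intro: psubset_card_mono)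
    with j show False by simp
  qed
qed

lemma sum_diff_exchange:
  fixes f :: "'a::finite \<Rightarrow> real"
  shows "sum f S - sum f I = sum f (S - I) - sum f (I - S)"
proof -
  have "sum f S = sum f (S - I) + sum f (S \<inter> I)"
    by (metis finite sum.Int_Diff add.commute)
  moreover have "sum f I = sum f (I - S) + sum f (S \<inter> I)"
    by (metis finite sum.Int_Diff add.commute Int_commute)
  ultimately show ?thesis by simp
qed

lemma bij_betw_exchange:
  fixes S I :: "'a::finite set"
  assumes "card S = card I"
  shows "\<exists>g. bij_betw g (I - S) (S - I)"
proof -
  have "card (S - I) = card (I - S)"
    using assms card_Diff_subset_Int[of S I] card_Diff_subset_Int[of I S]
    by (simp add: Int_commute)
  then show ?thesis by (intro finite_same_card_bij) auto
qed

text \<open>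
  Any bijection from \<open>I - S\<close> to \<open>S - I\<close> moves every index upwards, which can only increase \<open>b\<close>.
\<close>

lemma sum_down_set_le:
  fixes b :: "'a::{finite,linorder} \<Rightarrow> real"
  assumes "mono b" "down_set I" "card S = card I"
  shows "sum b I \<le> sum b S"
proof -
  obtain g where g: "bij_betw g (I - S) (S - I)" using bij_betw_exchange[OF assms(3)] by blast
  have "b i \<le> b (g i)" if "i \<in> I - S" for i
    using that bij_betwE[OF g] down_set_less[OF assms(2)] assms(1)
    by (metis Diff_iff less_imp_le monoD)
  then have "sum b (I - S) \<le> (\<Sum>i\<in>I - S. b (g i))" by (rule sum_mono)
  also have "\<dots> = sum b (S - I)" by (rule sum.reindex_bij_betw[OF g])
  finally show ?thesis using sum_diff_exchange[of b S I] by simp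
qed

text \<open>
  If the sums agree, the bijection \<open>g\<close> loses nothing at any single index. Two different indices are
  then compared by crossing over: with \<open>j = g a\<close> one has \<open>b j = b a \<le> b (g i) = b i \<le> b j\<close>.
\<close>

lemma sum_down_set_eq_imp_const:
  fixes b :: "'a::{finite,linorder} \<Rightarrow> real"
  assumes "mono b" "down_set I" "card S = card I" "sum b S = sum b I"
    and i: "i \<in> I - S" and j: "j \<in> S - I"
  shows "b i = b j"
proof -
  obtain g where g: "bij_betw g (I - S) (S - I)" using bij_betw_exchange[OF assms(3)] by blast
  have le: "b x \<le> b y" if "x \<in> I - S" "y \<in> S - I" for x y
    using that down_set_less[OF assms(2)] assms(1) by (metis Diff_iff less_imp_le monoD)
  have gm: "g x \<in> S - I" if "x \<in> I - S" for x using bij_betwE[OF g] that by blast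
  have "(\<Sum>x\<in>I - S. b (g x)) = sum b (S - I)" by (rule sum.reindex_bij_betw[OF g])
  also have "\<dots> = sum b (I - S)" using sum_diff_exchange[of b S I] assms(4) by simp
  finally have "(\<Sum>x\<in>I - S. b (g x) - b x) = 0" by (simp add: sum_subtractf)
  then have eq: "b (g x) = b x" if "x \<in> I - S" for x
    using that le gm by (subst (asm) sum_nonneg_eq_0_iff) auto
  have "j \<in> g ` (I - S)" using bij_betw_imp_surj_on[OF g] j by simp
  then obtain a where a: "a \<in> I - S" "g a = j" by (elim imageE) simp
  have "b j = b a" using eq[OF a(1)] a(2) by simp
  also have "\<dots> \<le> b (g i)" using le a(1) gm[OF i] by blast
  also have "\<dots> = b i" using eq[OF i] .
  finally show ?thesis using le[OF i j] by simp
qed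

text \<open>
  The combinatorial core. Let \<open>p\<close> be the least element of \<open>I - S\<close> and \<open>q\<close> the greatest element of
  \<open>S - I\<close>. The tie forces \<open>b p = b q\<close>, so \<open>b\<close> is constant and \<open>d\<close> increasing on \<open>{p..q}\<close>. This
  interval is cut by \<open>I\<close> into a lower part \<open>A\<close> and an upper part \<open>B\<close>. Maximality of \<open>I\<close>,
  compared with the smaller down-set \<open>{..<p}\<close> and the larger one \<open>{..q}\<close>, says that \<open>d\<close> has a
  nonnegative sum over \<open>A\<close> and a nonpositive sum over \<open>B\<close>; being increasing, it must vanish on both.
\<close>

lemma sum_eq_of_max_on_down_sets:
  fixes b d :: "'a::{finite,linorder} \<Rightarrow> real"
  assumes b: "mono b" and bd: "mono (\<lambda>j. b j + d j)"
    and I: "down_set I" and card: "card S = card I" and tie: "sum b S = sum b I"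
    and max: "\<And>J. down_set J \<Longrightarrow> sum d J \<le> sum d I"
  shows "sum d S = sum d I"
proof (cases "I - S = {} \<or> S - I = {}")
  case True
  then have "S = I" using card by (metis Diff_eq_empty_iff card_subset_eq finite)
  then show ?thesis by simp
next
  case False
  define p where "p = Min (I - S)"
  define q where "q = Max (S - I)"
  have p: "p \<in> I - S" and q: "q \<in> S - I"
    using False Min_in[of "I - S"] Max_in[of "S - I"] by (auto simp: p_def q_def)
  have bpq: "b p = b q" using sum_down_set_eq_imp_const[OF b I card tie p q] .
  have dmono: "d x \<le> d y" if "p \<le> x" "x \<le> y" "y \<le> q" for x y
  proof -
    have "b x = b y" using monoD[OF b that(1)] monoD[OF b that(2)] monoD[OF b that(3)] bpq by simp
    then show ?thesis using monoD[OF bd \<open>x \<le> y\<close>] by simp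
  qed
  define A where "A = I - {..<p}"
  define B where "B = {..q} - I"
  have A: "p \<le> x" "x \<le> q" if "x \<in> A" for x
    using that q down_set_less[OF I, of x q] by (auto simp: A_def)
  have B: "p \<le> x" "x \<le> q" if "x \<in> B" for x
    using that p down_set_less[OF I, of p x] by (auto simp: B_def)
  have AB: "d x \<le> d y" if "x \<in> A" "y \<in> B" for x y
    using that dmono[of x y] A(1) B(2) down_set_less[OF I, of x y] by (auto simp: A_def B_def)
  have pA: "p \<in> A" and qB: "q \<in> B" using p q by (auto simp: A_def B_def)
  have "sum d {..q} \<le> sum d I" by (rule max) (auto simp: down_set_def)
  moreover have "I \<subseteq> {..q}" using q down_set_less[OF I, of _ q] by (auto intro: less_imp_le)
  ultimately have sB: "sum d B \<le> 0" by (simp add: B_def sum_diff)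
  have "sum d {..<p} \<le> sum d I" by (rule max) (auto simp: down_set_def)
  moreover have "{..<p} \<subseteq> I" using p I by (auto simp: down_set_def)
  ultimately have sA: "sum d A \<ge> 0" by (simp add: A_def sum_diff)
  \<comment> \<open>A negative value in the upper part would make \<open>d\<close> negative on all of the lower part.\<close>
  have Bnn: "d y \<ge> 0" if "y \<in> B" for y
  proof (rule ccontr)
    assume "\<not> d y \<ge> 0"
    then have "\<And>x. x \<in> A \<Longrightarrow> d x < 0" using AB[OF _ that] by force
    then have "sum d A < 0" using pA sum_strict_mono[of A d "\<lambda>_. 0"] by auto
    with sA show False by simp
  qed
  have "sum d B = 0" using sB sum_nonneg[of B d] Bnn by force
  then have B0: "d y = 0" if "y \<in> B" for y
    using that Bnn by (subst (asm) sum_nonneg_eq_0_iff) auto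
  have Anp: "d x \<le> 0" if "x \<in> A" for x using AB[OF that qB] B0[OF qB] by simp
  have "sum d A = 0" using sA sum_nonpos[of A d] Anp by force
  then have A0: "d x = 0" if "x \<in> A" for x
    using that Anp sum_nonneg_eq_0_iff[of A "\<lambda>x. - d x"] by (auto simp: sum_negf)
  have "I - S \<subseteq> A" using Min_le[of "I - S"] by (auto simp: A_def p_def simp flip: not_le)
  moreover have "S - I \<subseteq> B" using Max_ge[of "S - I"] by (auto simp: B_def q_def)
  ultimately have "sum d (I - S) = 0" "sum d (S - I) = 0" using A0 B0 by (auto intro!: sum.neutral)
  then show ?thesis using sum_diff_exchange[of d S I] by simp
qed

section \<open>Symmetric multilinear functions\<close>

lemma symm_multilinear_permute:
  fixes x :: "real ^ 'n" and p :: "'n \<Rightarrow> 'n"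
  assumes "bij p"
  shows "symm_multilinear c (\<chi> j. x $ p j) = symm_multilinear c x"
proof -
  have "(\<Sum>J | card J = i. \<Prod>j\<in>J. x $ p j) = (\<Sum>J | card J = i. \<Prod>j\<in>J. x $ j)" for i
  proof -
    have inj: "inj_on p J" for J using assms by (meson bij_def inj_on_subset subset_UNIV)
    have "(\<Sum>J | card J = i. \<Prod>j\<in>J. x $ p j) = (\<Sum>J | card J = i. \<Prod>j\<in>p ` J. x $ j)"
      by (simp add: prod.reindex[OF inj] o_def)
    also have "\<dots> = (\<Sum>J | card J = i. \<Prod>j\<in>J. x $ j)"
    proof (rule sum.reindex_bij_betw)
      show "bij_betw ((`) p) {J. card J = i} {J. card J = i}"
      proof (rule bij_betw_byWitness[where f' = "(`) (inv p)"])
        show "\<forall>a\<in>{J. card J = i}. inv p ` p ` a = a"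
          using assms by (auto simp: image_comp bij_def)
        show "\<forall>a\<in>{J. card J = i}. p ` inv p ` a = a"
          using assms by (auto simp: image_comp bij_def surj_iff)
        show "(`) p ` {J. card J = i} \<subseteq> {J. card J = i}"
          using card_image[OF inj] by auto
        have "inj_on (inv p) J" for J
          using bij_imp_bij_inv[OF assms] by (meson bij_def inj_on_subset subset_UNIV)
        then show "(`) (inv p) ` {J. card J = i} \<subseteq> {J. card J = i}"
          using card_image by auto
      qed
    qed
    finally show ?thesis .
  qed
  then show ?thesis by (simp add: symm_multilinear_def)
qed

definition box_vertex :: "real \<Rightarrow> real \<Rightarrow> 'n set \<Rightarrow> real ^ 'n" where
  "box_vertex l u S = (\<chi> j. if j \<in> S then u else l)"

lemma symm_multilinear_vertex_cong:
  fixes S I :: "'n::finite set"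
  assumes "card S = card I"
  shows "symm_multilinear c (box_vertex l u S) = symm_multilinear c (box_vertex l u I)"
proof -
  obtain f where f: "bij_betw f S I" using assms finite_same_card_bij[of S I] by auto
  have "card (- S) = card (- I)" using assms by (simp add: Compl_eq_Diff_UNIV card_Diff_subset)
  then obtain g where g: "bij_betw g (- S) (- I)" using finite_same_card_bij[of "- S" "- I"] by auto
  define p :: "'n \<Rightarrow> 'n" where "p = (\<lambda>j. if j \<in> S then f j else g j)"
  have "bij_betw p S I" using f by (subst bij_betw_cong[of _ _ f]) (auto simp: p_def)
  moreover have "bij_betw p (- S) (- I)" using g by (subst bij_betw_cong[of _ _ g]) (auto simp: p_def)
  ultimately have p: "bij p" using bij_betw_combine[of p S I "- S" "- I"] by simp
  have "p j \<in> I \<longleftrightarrow> j \<in> S" for j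
    using bij_betwE[OF f] bij_betwE[OF g] by (auto simp: p_def)
  then have "box_vertex l u S = (\<chi> j. box_vertex l u I $ p j)"
    by (simp add: box_vertex_def vec_eq_iff)
  then show ?thesis using symm_multilinear_permute[OF p] by metis
qed

text \<open>
  A square-free monomial is affine in each single variable.
\<close>

lemma symm_multilinear_midpoint:
  fixes x :: "real ^ 'n"
  shows "symm_multilinear c (x + axis k e) + symm_multilinear c (x - axis k e)
    = 2 * symm_multilinear c x"
proof -
  have "(\<Prod>j\<in>J. (x + axis k e) $ j) + (\<Prod>j\<in>J. (x - axis k e) $ j) = 2 * (\<Prod>j\<in>J. x $ j)" for J
  proof (cases "k \<in> J")
    case True
    have "(\<Prod>j\<in>J. (x + axis k t) $ j) = (x $ k + t) * (\<Prod>j\<in>J - {k}. x $ j)" for t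
    proof -
      have "(\<Prod>j\<in>J - {k}. (x + axis k t) $ j) = (\<Prod>j\<in>J - {k}. x $ j)"
        by (rule prod.cong) (auto simp: axis_def)
      then show ?thesis using True by (simp add: prod.remove[of J k] axis_def)
    qed
    from this[of e] this[of "- e"] this[of 0] show ?thesis
      by (simp add: algebra_simps axis_def vec_eq_iff if_distrib cong: if_cong)
  next
    case False
    then have "(\<Prod>j\<in>J. (x + axis k t) $ j) = (\<Prod>j\<in>J. x $ j)" for t
      by (intro prod.cong) (auto simp: axis_def)
    from this[of e] this[of "- e"] show ?thesis
      by (simp add: axis_def if_distrib cong: if_cong)
  qed
  then show ?thesis
    by (simp add: symm_multilinear_def sum_distrib_left flip: sum.distrib distrib_left)
      (simp add: mult.left_commute)
qed

text \<open>
  Restriction to the diagonal loses no coefficient, so that the multilinear function can be studied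
  as a polynomial in one variable.
\<close>

lemma symm_multilinear_diagonal:
  "symm_multilinear c ((\<chi> j. t) :: real ^ 'n)
    = (\<Sum>i = 2..CARD('n). c i * real (CARD('n) choose i) * t ^ i)"
proof -
  have "(\<Sum>J | card J = i. \<Prod>j\<in>J. ((\<chi> j. t) :: real ^ 'n) $ j)
    = real (CARD('n) choose i) * t ^ i" for i
  proof -
    have "card {J :: 'n set. card J = i} = CARD('n) choose i"
      using n_subsets[of "UNIV :: 'n set" i] by simp
    then show ?thesis by simp
  qed
  then show ?thesis by (simp only: symm_multilinear_def mult.assoc)
qed

lemma continuous_on_symm_multilinear: "continuous_on A (symm_multilinear c)"
  unfolding symm_multilinear_def by (intro continuous_intros)


section \<open>The convex hull of the graph\<close>

lemma box_vertex_in_graphG: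
  assumes "l < u"
  shows "(box_vertex l u S, symm_multilinear c (box_vertex l u S)) \<in> graphG l u c"
  using assms by (simp add: graphG_def boxX_def box_vertex_def)

text \<open>
  Compactness makes the Krein--Milman theorem applicable to the faces of the convex hull.
\<close>

lemma compact_graphG: "compact (graphG l u c :: ((real ^ 'n) \<times> real) set)"
proof -
  have "graphG l u c = (\<lambda>x. (x, symm_multilinear c x)) ` (cbox (\<chi> j. l) (\<chi> j. u) :: (real ^ 'n) set)"
    by (auto simp: graphG_def boxX_def mem_box_cart)
  then show ?thesis
    by (auto intro!: compact_continuous_image continuous_on_Pair continuous_on_symm_multilinear)
qed

text \<open>
  If some \<open>x $ k\<close> were strictly between \<open>l\<close> and \<open>u\<close>, the point would be the midpoint of two other
  points of the graph, obtained by moving \<open>x\<close> by the same amount \<open>e\<close> in both directions along the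
  axis \<open>k\<close>, along which the function is affine.
\<close>

lemma extreme_point_graphG:
  fixes z :: "(real ^ 'n) \<times> real"
  assumes "z extreme_point_of (convex hull (graphG l u c))"
  obtains S where "z = (box_vertex l u S, symm_multilinear c (box_vertex l u S))"
proof -
  have "z \<in> graphG l u c" using extreme_point_of_convex_hull[OF assms] .
  then obtain x where z: "z = (x, symm_multilinear c x)" and x: "x \<in> boxX l u"
    by (auto simp: graphG_def)
  have ends: "x $ k = l \<or> x $ k = u" for k
  proof (rule ccontr)
    assume k: "\<not> (x $ k = l \<or> x $ k = u)"
    \<comment> \<open>the largest step that stays in the box in both directions\<close>
    define e where "e = min (x $ k - l) (u - x $ k)"
    have lk: "l \<le> x $ k" "x $ k \<le> u" using x by (auto simp: boxX_def)
    with k have e: "e > 0" by (auto simp: e_def)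
    define lift where "lift y = (y, symm_multilinear c y)" for y :: "real ^ 'n"
    have mem: "lift (x + axis k t) \<in> convex hull (graphG l u c)" if "\<bar>t\<bar> \<le> e" for t
    proof -
      have "x + axis k t \<in> boxX l u"
        using x that by (auto simp: boxX_def axis_def e_def abs_le_iff)
      then show ?thesis by (intro hull_inc) (simp add: graphG_def lift_def)
    qed
    have neg: "x - axis k e = x + axis k (- e)" by (simp add: vec_eq_iff axis_def)
    have "midpoint (lift (x - axis k e)) (lift (x + axis k e)) = z"
      using symm_multilinear_midpoint[of c x k e]
      by (simp add: midpoint_def lift_def z scaleR_2[symmetric])
    moreover have "lift (x - axis k e) \<noteq> lift (x + axis k e)"
      using e by (auto simp: lift_def vec_eq_iff axis_def dest: spec[of _ k])
    ultimately have "z \<in> open_segment (lift (x - axis k e)) (lift (x + axis k e))"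
      using midpoint_in_open_segment by metis
    moreover have "lift (x - axis k e) \<in> convex hull (graphG l u c)"
      unfolding neg using e by (intro mem) simp
    moreover have "lift (x + axis k e) \<in> convex hull (graphG l u c)"
      using e by (intro mem) simp
    ultimately show False using assms by (auto simp: extreme_point_of_def)
  qed
  have "x = box_vertex l u {j. x $ j = u}"
    using ends by (auto simp: box_vertex_def vec_eq_iff)
  with z that show thesis by metis
qed

lemma box_not_subset_hyperplane:
  fixes a :: "real ^ 'n"
  assumes "l < u" and box: "\<And>x. x \<in> boxX l u \<Longrightarrow> a \<bullet> x = g"
  shows "a = 0"
proof -
  have "a $ k = 0" for k
  proof -
    have "box_vertex l u {k} = box_vertex l u {} + axis k (u - l)"
      by (simp add: box_vertex_def vec_eq_iff axis_def)
    moreover have "a \<bullet> box_vertex l u {k} = g" "a \<bullet> box_vertex l u {} = g"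
      using assms(1) by (auto intro!: box simp: boxX_def box_vertex_def)
    ultimately have "a \<bullet> axis k (u - l) = 0" by (simp add: inner_add_right)
    then show ?thesis using assms(1) by (simp add: inner_axis)
  qed
  then show ?thesis by (simp add: vec_eq_iff)
qed

text \<open>
  On the diagonal, agreement with an affine function would be a polynomial identity in \<open>t\<close> on a whole
  interval. Its coefficients of degree \<open>i \<ge> 2\<close> are \<open>c i * (n choose i)\<close>, and one of them is nonzero.
\<close>

lemma symm_multilinear_not_affine:
  fixes a :: "real ^ 'n"
  assumes "l < u" and nz: "\<exists>i\<in>{2..CARD('n)}. c i \<noteq> 0"
    and aff: "\<And>x :: real ^ 'n. x \<in> boxX l u \<Longrightarrow> symm_multilinear c x = a \<bullet> x + g"
  shows False
proof -
  define s where "s = (\<Sum>j\<in>UNIV. a $ j)"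
  define n where "n = CARD('n)"
  \<comment> \<open>coefficients of \<open>m(t, ..., t) - (s t + g)\<close>\<close>
  define p where "p i = (if i = 0 then - g else if i = 1 then - s else c i * real (n choose i))" for i
  obtain m where m: "m \<in> {2..n}" "c m \<noteq> 0" using nz by (auto simp: n_def)
  have n2: "2 \<le> n" using m by simp
  have root: "(\<Sum>i\<le>n. p i * t ^ i) = 0" if t: "t \<in> {l..u}" for t
  proof -
    have "{..n} = insert 0 (insert 1 {2..n})" using n2 by auto
    then have "(\<Sum>i\<le>n. p i * t ^ i) = - g - s * t + (\<Sum>i = 2..n. p i * t ^ i)"
      by (simp add: p_def)
    also have "(\<Sum>i = 2..n. p i * t ^ i) = (\<Sum>i = 2..n. c i * real (n choose i) * t ^ i)"
      by (rule sum.cong) (auto simp: p_def)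
    also have "\<dots> = symm_multilinear c ((\<chi> j. t) :: real ^ 'n)"
      by (simp add: symm_multilinear_diagonal n_def)
    also have "\<dots> = s * t + g"
      using t by (subst aff) (auto simp: boxX_def s_def inner_vec_def sum_distrib_right)
    finally show ?thesis by simp
  qed
  have "\<exists>k\<le>n. p k \<noteq> 0" using m by (intro exI[of _ m]) (auto simp: p_def)
  then have "finite {t. (\<Sum>i\<le>n. p i * t ^ i) = 0}" by (simp add: polyfun_finite_roots)
  moreover have "{l..u} \<subseteq> {t. (\<Sum>i\<le>n. p i * t ^ i) = 0}" using root by auto
  ultimately show False using infinite_Icc[OF assms(1)] finite_subset by blast
qed

text \<open>
  Otherwise the graph lies in a hyperplane. If that hyperplane is vertical, the box lies in a
  hyperplane of \<open>\<real>\<^sup>n\<close>; if not, the function is affine on the box.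
\<close>

lemma aff_dim_convex_hull_graphG:
  fixes c :: "nat \<Rightarrow> real"
  assumes "l < u" and nz: "\<exists>i\<in>{2..CARD('n)}. c i \<noteq> 0"
  shows "aff_dim (convex hull (graphG l u c :: ((real ^ 'n) \<times> real) set))
    = DIM((real ^ 'n) \<times> real)"
proof (rule ccontr)
  assume "\<not> ?thesis"
  then have "aff_dim (graphG l u c :: ((real ^ 'n) \<times> real) set) < DIM((real ^ 'n) \<times> real)"
    using aff_dim_le_DIM[of "graphG l u c :: ((real ^ 'n) \<times> real) set"]
    by (simp add: aff_dim_convex_hull)
  then obtain w g where w: "w \<noteq> 0"
    and sub: "(graphG l u c :: ((real ^ 'n) \<times> real) set) \<subseteq> {z. w \<bullet> z = g}"
    using aff_lowdim_subset_hyperplane by blast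
  obtain a b where wab: "w = (a, b)" by (cases w)
  have eq: "a \<bullet> x + b * symm_multilinear c x = g" if "x \<in> boxX l u" for x
    using sub that by (force simp: graphG_def wab)
  show False
  proof (cases "b = 0")
    case True
    then have "a = 0" using box_not_subset_hyperplane[OF assms(1), of a g] eq by simp
    with True w wab show False by (simp add: zero_prod_def)
  next
    case False
    have "symm_multilinear c x = (- (1 / b) *\<^sub>R a) \<bullet> x + g / b" if "x \<in> boxX l u" for x
      using eq[OF that] False by (simp add: field_simps)
    then show False using symm_multilinear_not_affine[OF assms] by blast
  qed
qed

text \<open>
  A facet of a full-dimensional set spans the hyperplane \<open>K\<close> that contains it. An affine function that
  vanishes on the facet vanishes on \<open>K\<close>, and as \<open>b' \<noteq> 0\<close> there is a point of \<open>K\<close> above every \<open>x\<close>.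
\<close>

lemma facet_subset_hyperplane_fst:
  fixes P :: "('a::euclidean_space \<times> real) set"
  assumes full: "aff_dim P = DIM('a \<times> real)" and facet: "F facet_of P"
    and H: "\<And>x y. (x, y) \<in> F \<Longrightarrow> b0 + b \<bullet> x + b' * y = 0" and b': "b' \<noteq> 0"
    and D: "\<And>x y. (x, y) \<in> F \<Longrightarrow> d0 + d \<bullet> x = 0"
  shows "d0 + d \<bullet> x = 0"
proof -
  define K where "K = {z. (b, b') \<bullet> z = - b0}"
  have FK: "affine hull F \<subseteq> K"
    using H by (intro hull_minimal) (force simp: K_def affine_hyperplane)+
  have "aff_dim K = DIM('a \<times> real) - 1"
    unfolding K_def using b' by (subst aff_dim_hyperplane) (auto simp: zero_prod_def)
  moreover have "aff_dim F = DIM('a \<times> real) - 1" using facet full by (simp add: facet_of_def)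
  ultimately have "affine hull F = K"
    using facet by (intro affine_dim_equal FK) (auto simp: K_def affine_hyperplane facet_of_def)
  moreover have "affine hull F \<subseteq> {z. (d, 0) \<bullet> z = - d0}"
    using D by (intro hull_minimal) (force simp: affine_hyperplane)+
  moreover have "(x, - (b0 + b \<bullet> x) / b') \<in> K" using b' by (simp add: K_def)
  ultimately have "(x, - (b0 + b \<bullet> x) / b') \<in> {z. (d, 0) \<bullet> z = - d0}" by blast
  then show ?thesis by simp
qed

section \<open>Core inequalities at the vertices of the box\<close>

text \<open>
  Written this way, comparing two vertices amounts to comparing the sums of the coefficients over
  the two index sets.
\<close>

lemma inner_box_vertex:
  fixes b :: "real ^ 'n"
  shows "b \<bullet> box_vertex l u S = (u - l) * (\<Sum>j\<in>S. b $ j) + l * (\<Sum>j\<in>UNIV. b $ j)"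
proof -
  have "b \<bullet> box_vertex l u S = (\<Sum>j\<in>UNIV. (u - l) * (if j \<in> S then b $ j else 0) + l * b $ j)"
    by (auto simp: inner_vec_def box_vertex_def algebra_simps intro!: sum.cong)
  also have "\<dots> = (u - l) * (\<Sum>j\<in>S. b $ j) + l * (\<Sum>j\<in>UNIV. b $ j)"
    by (simp add: sum.distrib sum_distrib_left[symmetric] sum.If_cases)
  finally show ?thesis .
qed

lemma ineq_lhs_inner: "ineq_lhs b0 b b' x y = b0 + b \<bullet> x + b' * y"
  by (simp add: ineq_lhs_def inner_vec_def)

lemma Lval_eq_down_set:
  fixes b :: "real ^ 'n::{finite,linorder}"
  assumes "down_set I"
  shows "Lval l u (card I) b0 b = b0 + b \<bullet> box_vertex l u I"
proof -
  have I: "{j. pos j \<le> card I} = I" by (rule down_set_eq_pos_le_card[OF assms])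
  have "{j. pos j > card I} = - I" using I by (auto simp: not_le[symmetric])
  moreover have "(\<Sum>j\<in>- I. b $ j) = (\<Sum>j\<in>UNIV. b $ j) - (\<Sum>j\<in>I. b $ j)"
    by (simp add: Compl_eq_Diff_UNIV sum_diff)
  ultimately show ?thesis
    by (simp only: Lval_def I inner_box_vertex) (simp only: algebra_simps)
qed

lemma valid_ineq_at_vertex:
  assumes "l < u" "valid_ineq (convex hull (graphG l u c)) b0 b b'"
  shows "b0 + b \<bullet> box_vertex l u S + b' * symm_multilinear c (box_vertex l u S) \<ge> 0"
  using assms(2) hull_inc[OF box_vertex_in_graphG[OF assms(1), of S c], of convex]
  by (auto simp: valid_ineq_def ineq_lhs_inner)

text \<open>
  Tightness at \<open>S\<close> is transferred to the down-set \<open>I\<close> of the same size, where validity of the first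
  inequality and domination by the second force both to agree. The exchange lemma
  \<open>sum_eq_of_max_on_down_sets\<close>, applied to the coefficients of the difference, carries the
  agreement back to \<open>S\<close>.
\<close>

lemma tight_vertex_agree:
  fixes bbar bhat :: "real ^ 'n::{finite,linorder}"
  assumes lu: "l < u"
    and bar: "valid_core_ineq (convex hull (graphG l u c)) bbar0 bbar b'"
    and hat: "valid_core_ineq (convex hull (graphG l u c)) bhat0 bhat b'"
    and le: "\<And>J :: 'n set. down_set J \<Longrightarrow>
      bbar0 + bbar \<bullet> box_vertex l u J \<le> bhat0 + bhat \<bullet> box_vertex l u J"
    and tight: "bhat0 + bhat \<bullet> box_vertex l u S + b' * symm_multilinear c (box_vertex l u S) = 0"
  shows "bbar0 + bbar \<bullet> box_vertex l u S = bhat0 + bhat \<bullet> box_vertex l u S"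
proof -
  have mono: "mono (($) bbar)" "mono (($) bhat)"
    using bar hat by (auto simp: valid_core_ineq_def core_ineq_def)
  have valid: "valid_ineq (convex hull (graphG l u c)) bbar0 bbar b'"
    "valid_ineq (convex hull (graphG l u c)) bhat0 bhat b'"
    using bar hat by (auto simp: valid_core_ineq_def)
  obtain I :: "'n set" where I: "down_set I" "card S = card I"
    using down_set_ex_card[where 'n = 'n and k = "card S"] card_mono[of UNIV S] by auto
  have m: "symm_multilinear c (box_vertex l u S) = symm_multilinear c (box_vertex l u I)"
    by (rule symm_multilinear_vertex_cong[OF I(2)])
  have hatI: "bhat0 + bhat \<bullet> box_vertex l u I + b' * symm_multilinear c (box_vertex l u I) \<ge> 0"
    by (rule valid_ineq_at_vertex[OF lu valid(2)])
  have barI: "bbar0 + bbar \<bullet> box_vertex l u I + b' * symm_multilinear c (box_vertex l u I) \<ge> 0"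
    by (rule valid_ineq_at_vertex[OF lu valid(1)])
  have "(u - l) * sum (($) bhat) I \<le> (u - l) * sum (($) bhat) S"
    using sum_down_set_le[OF mono(2) I] lu by (intro mult_left_mono) auto
  then have eqI: "bhat \<bullet> box_vertex l u S = bhat \<bullet> box_vertex l u I"
    using tight hatI unfolding inner_box_vertex m by linarith
  then have tie: "sum (($) bhat) S = sum (($) bhat) I"
    using lu by (simp add: inner_box_vertex)
  have agreeI: "bbar0 + bbar \<bullet> box_vertex l u I = bhat0 + bhat \<bullet> box_vertex l u I"
    using le[OF I(1)] barI tight m eqI by simp
  define d where "d = bbar - bhat"
  have dv: "d \<bullet> box_vertex l u J = bbar \<bullet> box_vertex l u J - bhat \<bullet> box_vertex l u J" for J
    by (simp add: d_def inner_diff_left)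
  have "sum (($) d) J \<le> sum (($) d) I" if "down_set J" for J
  proof -
    have "d \<bullet> box_vertex l u J \<le> d \<bullet> box_vertex l u I"
      using le[OF that] agreeI unfolding dv by simp
    then have "(u - l) * sum (($) d) J \<le> (u - l) * sum (($) d) I" by (simp add: inner_box_vertex)
    then show ?thesis using lu by simp
  qed
  moreover have "mono (\<lambda>j. bhat $ j + d $ j)" using mono(1) by (simp add: d_def mono_def)
  ultimately have "sum (($) d) S = sum (($) d) I"
    using sum_eq_of_max_on_down_sets[OF mono(2) _ I tie] by blast
  then have "d \<bullet> box_vertex l u S = d \<bullet> box_vertex l u I" by (simp add: inner_box_vertex)
  then show ?thesis using agreeI eqI unfolding dv by simp
qed

theorem proposition3p3:
  fixes l u :: real
    and c :: "nat \<Rightarrow> real"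
    and bbar0 bhat0 b' :: real
    and bbar bhat :: "real ^ 'n::{finite,linorder}"
  assumes "CARD('n) \<ge> 2"
    and "l < u"
    and "\<exists>i\<in>{2..CARD('n)}. c i \<noteq> 0"
    and "valid_core_ineq (convex hull (graphG l u c)) bbar0 bbar b'"
    and "valid_core_ineq (convex hull (graphG l u c)) bhat0 bhat b'"
    and "\<forall>k\<in>{0..CARD('n)}. Lval l u k bbar0 bbar \<le> Lval l u k bhat0 bhat"
    and "\<exists>k\<in>{0..CARD('n)}. Lval l u k bbar0 bbar < Lval l u k bhat0 bhat"
  shows "\<not> is_facet_ineq (convex hull (graphG l u c)) bhat0 bhat b'"
proof
  let ?P = "convex hull (graphG l u c) :: ((real ^ 'n::{finite,linorder}) \<times> real) set"
  assume "is_facet_ineq ?P bhat0 bhat b'"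
  then obtain F where F: "F facet_of ?P"
    and F_def: "F = {(x, y) \<in> ?P. ineq_lhs bhat0 bhat b' x y = 0}"
    by (auto simp: is_facet_ineq_def)
  have face: "F face_of ?P" using F by (simp add: facet_of_def)
  have le: "bbar0 + bbar \<bullet> box_vertex l u J \<le> bhat0 + bhat \<bullet> box_vertex l u J"
    if "down_set J" for J
    using assms(6) card_mono[of UNIV J] by (simp flip: Lval_eq_down_set[OF that])
  define d0 where "d0 = bbar0 - bhat0"
  define d where "d = bbar - bhat"
  have "compact F"
    by (rule face_of_imp_compact[OF convex_convex_hull compact_convex_hull[OF compact_graphG] face])
  then have "F = convex hull {z. z extreme_point_of F}"
    using face by (intro Krein_Milman_Minkowski face_of_imp_convex)
  \<comment> \<open>A hyperplane is convex, so only the extreme points of \<open>F\<close> need to be checked.\<close>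
  also have "\<dots> \<subseteq> {z. (d, 0) \<bullet> z = - d0}"
  proof (intro hull_minimal subsetI convex_hyperplane, clarify)
    fix x y assume "(x, y) extreme_point_of F"
    then have ext: "(x, y) extreme_point_of ?P" and "(x, y) \<in> F"
      using extreme_point_of_face[OF face] by auto
    obtain S where S: "x = box_vertex l u S" "y = symm_multilinear c (box_vertex l u S)"
      using extreme_point_graphG[OF ext] by auto
    have "bbar0 + bbar \<bullet> box_vertex l u S = bhat0 + bhat \<bullet> box_vertex l u S"
      using \<open>(x, y) \<in> F\<close> S
      by (intro tight_vertex_agree[OF assms(2,4,5) le]) (auto simp: F_def ineq_lhs_inner)
    then show "(d, 0) \<bullet> (x, y) = - d0" by (simp add: S d_def d0_def inner_diff_left)
  qed
  finally have van: "d0 + d \<bullet> x = 0" if "(x, y) \<in> F" for x y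
    using that by (force simp: inner_Pair)
  have "b' \<noteq> 0" using assms(5) by (auto simp: valid_core_ineq_def core_ineq_def)
  moreover have "bhat0 + bhat \<bullet> x + b' * y = 0" if "(x, y) \<in> F" for x y
    using that by (simp add: F_def ineq_lhs_inner)
  ultimately have zero: "d0 + d \<bullet> x = 0" for x
    using facet_subset_hyperplane_fst[OF aff_dim_convex_hull_graphG[OF assms(2,3)] F] van by blast
  obtain k where k: "k \<le> CARD('n)" "Lval l u k bbar0 bbar < Lval l u k bhat0 bhat"
    using assms(7) by auto
  obtain I :: "'n set" where I: "down_set I" "card I = k" using down_set_ex_card[OF k(1)] by blast
  have "bbar0 + bbar \<bullet> box_vertex l u I < bhat0 + bhat \<bullet> box_vertex l u I"
    using k(2) Lval_eq_down_set[OF I(1)] I(2) by metis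
  with zero[of "box_vertex l u I"] show False by (simp add: d_def d0_def inner_diff_left)
qed

end
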